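(* There is an uncountable set of pairwise disjoint indecomposable continua in the plane $\mathbb{C}$, each of which contains a dense injective curve.
   Context: A continuum is a nonempty compact connected metric space with more than one point; it is indecomposable if it is not the union of two proper subcontinua. An injective curve is the image of an interval under a continuous injective map; it is dense in the continuum if its closure is the whole continuum. *)

theory Defs
  imports "HOL-Analysis.Analysis"
begin

definition continuum :: "'a::metric_space set \<Rightarrow> bool" where
  "continuum X \<longleftrightarrow> compact X \<and> connected X \<and> (\<exists>x\<in>X. \<exists>y\<in>X. x \<noteq> y)"

definition indecomposable_continuum :: "'a::metric_space set \<Rightarrow> bool" where
  "indecomposable_continuum X \<longleftrightarrow>
     continuum X \<and> \<not> (\<exists>A B. continuum A \<and> continuum B \<and> A \<subset> X \<and> B \<subset> X \<and> X = A \<union> B)"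

text \<open>The interval may be open, half-open, closed or unbounded. Continuity and injectivity alone
  are required, so the parametrisation need not be a homeomorphism onto the curve.\<close>
definition injective_curve :: "'a::metric_space set \<Rightarrow> bool" where
  "injective_curve C \<longleftrightarrow>
     (\<exists>(I :: real set) \<gamma>. is_interval I \<and> continuous_on I \<gamma> \<and> inj_on \<gamma> I \<and> C = \<gamma> ` I)"

text \<open>Degenerate intervals are harmless here: a curve with at most one point is never dense in
  a continuum. As a continuum \<open>X\<close> is closed, the closure of \<open>C \<subseteq> X\<close> in the ambient space agrees
  with its closure relative to \<open>X\<close>.\<close>
definition contains_dense_injective_curve :: "'a::metric_space set \<Rightarrow> bool" where
  "contains_dense_injective_curve X \<longleftrightarrow> (\<exists>C. injective_curve C \<and> C \<subseteq> X \<and> closure C = X)"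

end

theory Submission
  imports Defs
begin

text \<open>
  Each continuum is a planar copy of the inverse limit \<open>K\<close> of the map \<open>u \<mapsto> 2u\<^sup>2 - 1\<close> of \<open>[-1,1]\<close>, the
  Knaster continuum. Since both \<open>[-1,0]\<close> and \<open>[0,1]\<close> are mapped onto \<open>[-1,1]\<close>, of two subcontinua
  covering \<open>K\<close> one projects onto \<open>[-1,1]\<close> in infinitely many coordinates, hence is all of \<open>K\<close>. The
  threads \<open>(cos (t/2^n))\<close> with \<open>t \<ge> 0\<close> form a dense injective curve.

  For the disjoint planar copies, the points with first coordinate \<open>0\<close> are put at the heights \<open>y\<close>
  whose orbit under an expanding zigzag map \<open>f\<close> stays in \<open>[-1,1]\<close>. The sign of \<open>f^n y\<close> chooses the preimage
  under \<open>u \<mapsto> 2u\<^sup>2 - 1\<close> in the coordinate \<open>n + 1\<close>, and the comparison of \<open>|f^n y|\<close> with \<open>1/2\<close> is the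
  \<open>n\<close>-th bit of the index of the copy. Strands are joined by non-crossing caps: at \<open>u = -1\<close> the strand of
  \<open>y\<close> meets that of \<open>-y\<close>, and at \<open>u = 1\<close> it meets its mirror image in a centre that depends on
  the orbit up to its first negative term and the bits up to there.
\<close>

subsection \<open>Inverse limits of the doubling polynomial\<close>

text \<open>Such an \<open>X\<close> is a homeomorphic copy of the inverse limit:
  \<open>separating\<close> makes the map to threads injective, and compactness together with
  \<open>range\<close> makes it surjective.\<close>

locale chebyshev_limit =
  fixes X :: "'a::euclidean_space set" and p :: "nat \<Rightarrow> 'a \<Rightarrow> real"
  assumes compact: "compact X"
    and continuous: "continuous_on X (p n)"
    and double: "z \<in> X \<Longrightarrow> p n z = 2 * (p (Suc n) z)\<^sup>2 - 1"
    and separating: "\<lbrakk>z \<in> X; z' \<in> X; \<And>n. p n z = p n z'\<rbrakk> \<Longrightarrow> z = z'"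
    and range: "p n ` X = {-1..1}"
begin

lemma coords_eqI:
  assumes "z \<in> X" "p n z = x n" "\<And>n. x n = 2 * (x (Suc n))\<^sup>2 - 1" "m \<le> n"
  shows "p m z = x m"
  using assms(4,2) by (induction rule: inc_induct) (metis assms(1,3) double)+

text \<open>The points of \<open>A\<close> with the right \<open>n\<close>-th coordinate form a
  nonempty compact set. These sets decrease in \<open>n\<close>, because a coordinate determines all
  earlier ones.\<close>

lemma realize_thread:
  assumes A: "compact A" "A \<subseteq> X"
    and x: "\<And>n. x n = 2 * (x (Suc n))\<^sup>2 - 1" and mem: "\<And>n. x n \<in> p n ` A"
  obtains a where "a \<in> A" "\<And>n. p n a = x n"
proof -
  define F where "F n = {a \<in> A. p n a = x n}" for n
  have "\<Inter> (range F) \<noteq> {}"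
  proof (rule compact_nest)
    show "compact (F n)" for n
    proof -
      have "closed (F n)"
        unfolding F_def using continuous_on_subset[OF continuous A(2)] A(1)
        by (intro continuous_closed_preimage_constant) (auto intro: compact_imp_closed)
      then show ?thesis
        using compact_Int_closed[OF A(1), of "F n"] by (simp add: F_def Int_def conj_commute cong: conj_cong)
    qed
    show "F n \<noteq> {}" for n
      using mem[of n] by (auto simp: F_def)
    show "F n \<subseteq> F m" if "m \<le> n" for m n
      using that A(2) coords_eqI[where x = x, OF _ _ x] by (auto simp: F_def)
  qed
  then obtain a where "\<And>n. a \<in> F n"
    by auto
  then show ?thesis
    using that by (auto simp: F_def)
qed

lemma full_coords_imp_eq:
  assumes "compact A" "A \<subseteq> X" "\<And>n. p n ` A = {-1..1}"
  shows "A = X"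
proof -
  have "z \<in> A" if z: "z \<in> X" for z
  proof -
    have "p n z \<in> p n ` A" for n
      using z unfolding assms(3) range[of n, symmetric] by blast
    then obtain a where "a \<in> A" "\<And>n. p n a = p n z"
      using realize_thread[of A "\<lambda>n. p n z", OF assms(1,2) double[OF z]] by blast
    then show ?thesis
      using separating[of a z] z assms(2) by auto
  qed
  then show ?thesis
    using assms(2) by auto
qed

lemma full_coord_if_half:
  assumes "A \<subseteq> X" "{-1..0} \<subseteq> p (Suc n) ` A \<or> {0..1} \<subseteq> p (Suc n) ` A"
  shows "p n ` A = {-1..1}"
proof
  show "p n ` A \<subseteq> {-1..1}"
    using assms(1) range by blast
  show "{-1..1} \<subseteq> p n ` A"
  proof
    fix u :: real
    assume u: "u \<in> {-1..1}"
    \<comment> \<open>The two preimages \<open>r\<close> and \<open>- r\<close> of \<open>u\<close>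
      lie one in each half, so either half suffices.\<close>
    define r where "r = sqrt ((1 + u) / 2)"
    have "0 \<le> r" "r \<le> 1" and r: "2 * r\<^sup>2 - 1 = u"
      using u by (simp_all add: r_def add_divide_distrib)
    then have "r \<in> {0..1}" "- r \<in> {-1..0}"
      by simp_all
    then have "r \<in> p (Suc n) ` A \<or> - r \<in> p (Suc n) ` A"
      using assms(2) by blast
    then obtain a where "a \<in> A" and a: "p (Suc n) a = r \<or> p (Suc n) a = - r"
      by (elim disjE imageE) auto
    have "(p (Suc n) a)\<^sup>2 = r\<^sup>2"
      using a by (elim disjE) simp_all
    moreover have "a \<in> X"
      using \<open>a \<in> A\<close> assms(1) by blast
    ultimately have "p n a = u"
      using double[of a n] r by simp
    then show "u \<in> p n ` A"
      using \<open>a \<in> A\<close> by blast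
  qed
qed

text \<open>Pigeonhole on -1, 0, 1 one coordinate further: one of the two image intervals contains
  two of these points, hence a whole half of [-1,1], and doubling maps either half onto
  [-1,1].\<close>

lemma full_coord_union:
  assumes "connected A" "connected B" "A \<union> B = X"
  shows "p n ` A = {-1..1} \<or> p n ` B = {-1..1}"
proof -
  have int: "is_interval (p (Suc n) ` A)" "is_interval (p (Suc n) ` B)"
    using assms continuous[of "Suc n"]
    by (auto simp: is_interval_connected_1 intro!: connected_continuous_image intro: continuous_on_subset)
  have "x \<in> p (Suc n) ` A \<or> x \<in> p (Suc n) ` B" if "x \<in> {-1..1}" for x
    using that range[of "Suc n"] assms(3) by (metis UnE image_Un)
  from this[of 0] this[of 1] this[of "-1"]
  have ends: "0 \<in> p (Suc n) ` A \<or> 0 \<in> p (Suc n) ` B" "1 \<in> p (Suc n) ` A \<or> 1 \<in> p (Suc n) ` B"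
      "-1 \<in> p (Suc n) ` A \<or> -1 \<in> p (Suc n) ` B"
    by auto
  have half: "{-1..0} \<subseteq> J \<or> {0..1} \<subseteq> J"
    if "is_interval J" and J: "0 \<in> J \<and> (1 \<in> J \<or> -1 \<in> J) \<or> 1 \<in> J \<and> -1 \<in> J" for J :: "real set"
  proof -
    have between: "{a..b} \<subseteq> J" if ab: "a \<in> J" "b \<in> J" for a b
      using mem_is_interval_1_I[OF \<open>is_interval J\<close> ab] by (auto simp: subset_iff)
    have "{0..1} \<subseteq> J" if "-1 \<in> J" "1 \<in> J"
      using between[OF that] by (rule order_trans[rotated]) simp
    then show ?thesis
      using J between[of 0 1] between[of "-1" 0] by argo
  qed
  show ?thesis
  proof (cases "0 \<in> p (Suc n) ` A \<and> (1 \<in> p (Suc n) ` A \<or> -1 \<in> p (Suc n) ` A) \<or>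
      1 \<in> p (Suc n) ` A \<and> -1 \<in> p (Suc n) ` A")
    case True
    then show ?thesis
      using full_coord_if_half[OF _ half[OF int(1) True]] assms(3) by (metis Un_upper1)
  next
    case False
    then have "0 \<in> p (Suc n) ` B \<and> (1 \<in> p (Suc n) ` B \<or> -1 \<in> p (Suc n) ` B) \<or>
      1 \<in> p (Suc n) ` B \<and> -1 \<in> p (Suc n) ` B"
      using ends by argo
    then show ?thesis
      using full_coord_if_half[OF _ half[OF int(2)]] assms(3) by (metis Un_upper2)
  qed
qed

lemma full_coord_mono:
  assumes "A \<subseteq> X" "p n ` A = {-1..1}" "m \<le> n"
  shows "p m ` A = {-1..1}"
  using assms(3,2) 
proof (induction rule: inc_induct)
  case (step k)
  then have "p (Suc k) ` A = {-1..1}"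
    by blast
  then show ?case
    by (intro full_coord_if_half[OF assms(1)]) simp
qed

lemma not_union_of_proper_subcontinua:
  assumes "compact A" "connected A" "compact B" "connected B" "A \<union> B = X"
  shows "A = X \<or> B = X"
proof (cases "\<forall>n. p n ` A = {-1..1}")
  case True
  then show ?thesis
    using full_coords_imp_eq[of A] assms by blast
next
  case False
  then obtain m where m: "p m ` A \<noteq> {-1..1}"
    by blast
  have "p n ` B = {-1..1}" for n
  proof -
    \<comment> \<open>Fullness descends to smaller indices, so the failure of \<open>A\<close> at
      \<open>m\<close> persists at \<open>max m n\<close>. There \<open>B\<close> must be full, and
      this descends to \<open>n\<close>.\<close>
    have "p (max m n) ` A \<noteq> {-1..1}"
      using full_coord_mono[of A "max m n" m] m assms(5) by (metis Un_upper1 max.cobounded1)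
    then have "p (max m n) ` B = {-1..1}"
      using full_coord_union[of A B] assms by blast
    then show ?thesis
      using full_coord_mono[of B "max m n" n] assms(5) by (metis Un_upper2 max.cobounded2)
  qed
  then show ?thesis
    using full_coords_imp_eq[of B] assms by blast
qed

text \<open>The thread of \<open>t\<close> is \<open>cos t, cos (t/2), cos (t/4), \<dots>\<close>. For large \<open>n\<close> the angle \<open>t/2^n\<close> lies in
  \<open>[0, \<pi>]\<close>, where \<open>cos\<close> is injective.\<close>
lemma dense_curve:
  obtains \<gamma> :: "real \<Rightarrow> 'a" where "continuous_on {0..} \<gamma>" "inj_on \<gamma> {0..}" "\<gamma> ` {0..} \<subseteq> X" "closure (\<gamma> ` {0..}) = X"
proof -
  have "\<exists>z\<in>X. \<forall>n. p n z = cos (t / 2 ^ n)" for t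
  proof -
    have "cos (t / 2 ^ n) = 2 * (cos (t / 2 ^ Suc n))\<^sup>2 - 1" for n
      using cos_double_cos[of "t / 2 ^ Suc n"] by simp
    then show ?thesis
      using realize_thread[of X "\<lambda>n. cos (t / 2 ^ n)", OF compact order_refl] unfolding range
      by (metis atLeastAtMost_iff cos_ge_minus_one cos_le_one)
  qed
  then obtain \<gamma> where \<gamma>: "\<And>t. \<gamma> t \<in> X" "\<And>t n. p n (\<gamma> t) = cos (t / 2 ^ n)"
    by metis
  have "continuous_on {0..} \<gamma>"
  proof (rule continuous_from_closed_graph[OF compact])
    \<comment> \<open>Since the coordinates separate points, the graph is cut out by one closed
      equation per coordinate.\<close>
    have "(\<lambda>t. (t, \<gamma> t)) ` {0..} = (\<Inter>n. {w \<in> {0..} \<times> X. p n (snd w) - cos (fst w / 2 ^ n) = 0})"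
    proof (intro equalityI subsetI)
      fix w
      assume w: "w \<in> (\<Inter>n. {w \<in> {0..} \<times> X. p n (snd w) - cos (fst w / 2 ^ n) = 0})"
      then have "snd w = \<gamma> (fst w)"
        by (intro separating) (auto simp: \<gamma>)
      then show "w \<in> (\<lambda>t. (t, \<gamma> t)) ` {0..}"
        using w by (auto intro!: image_eqI[of _ _ "fst w"] prod_eqI)
    qed (use \<gamma> in auto)
    also have "closed \<dots>"
      using compact by (intro closed_INT ballI continuous_closed_preimage_constant continuous_intros
          continuous_on_compose2[OF continuous] closed_Times) (auto intro: compact_imp_closed)
    finally show "closed ((\<lambda>t. (t, \<gamma> t)) ` {0..})" .
  qed (use \<gamma> in auto)
  moreover have "inj_on \<gamma> {0..}"
  proof (rule inj_onI)
    fix s t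
    assume st: "s \<in> {0..}" "t \<in> {0..}" "\<gamma> s = \<gamma> t"
    obtain n where n: "max s t / pi < 2 ^ n"
      using real_arch_pow[of 2] by auto
    then have "max s t < 2 ^ n * pi"
      by (simp add: pos_divide_less_eq)
    then have "s / 2 ^ n \<le> pi" "t / 2 ^ n \<le> pi"
      by (simp_all add: pos_divide_le_eq mult.commute)
    then show "s = t"
      using cos_inj_pi[of "s / 2 ^ n" "t / 2 ^ n"] st \<gamma>(2)[of n s] \<gamma>(2)[of n t] by auto
  qed
  moreover have "closure (\<gamma> ` {0..}) = X"
  proof (rule full_coords_imp_eq)
    show sub: "closure (\<gamma> ` {0..}) \<subseteq> X"
      using \<gamma>(1) compact by (intro closure_minimal) (auto intro: compact_imp_closed)
    show "compact (closure (\<gamma> ` {0..}))"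
      using compact_Int_closed[OF compact closed_closure, of "\<gamma> ` {0..}"] sub
      by (simp add: Int_absorb1)
    fix n
    \<comment> \<open>The curve alone already fills every coordinate, so its closure is a full
      compact subset.\<close>
    have "u \<in> p n ` \<gamma> ` {0..}" if "u \<in> {-1..1}" for u
    proof -
      have "p n (\<gamma> (2 ^ n * arccos u)) = u" "2 ^ n * arccos u \<ge> 0"
        using that \<gamma>(2)[of n] arccos_lbound[of u] by auto
      then show ?thesis
        by (metis atLeast_iff imageI)
    qed
    then show "p n ` closure (\<gamma> ` {0..}) = {-1..1}"
      using closure_subset[of "\<gamma> ` {0..}"] sub range[of n] by blast
  qed
  ultimately show ?thesis
    using that[of \<gamma>] \<gamma>(1) by blast
qed

lemma indecomposable: "indecomposable_continuum X"
proof -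
  obtain \<gamma> where "continuous_on {0..} \<gamma>" "closure (\<gamma> ` {0::real..}) = X"
    using dense_curve by blast
  then have "connected X"
    using connected_imp_connected_closure[OF connected_continuous_image[OF _ connected_Ici]] by metis
  moreover have "\<exists>x\<in>X. \<exists>y\<in>X. x \<noteq> y"
  proof -
    have "-1 \<in> p 0 ` X" "1 \<in> p 0 ` X"
      unfolding range by auto
    then obtain a b where "a \<in> X" "b \<in> X" "p 0 a = -1" "p 0 b = 1"
      by force
    then have "a \<noteq> b"
      by auto
    then show ?thesis
      using \<open>a \<in> X\<close> \<open>b \<in> X\<close> by blast
  qed
  ultimately show ?thesis
    unfolding indecomposable_continuum_def continuum_def
    using compact not_union_of_proper_subcontinua by (simp, blast)
qed

lemma dense_injective_curve: "contains_dense_injective_curve X"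
  using dense_curve unfolding contains_dense_injective_curve_def injective_curve_def
  by (metis is_interval_ci)

end

subsection \<open>The Cantor set of heights\<close>

text \<open>Four affine branches of slope 8 or -8, one for each pair of signs \<open>sgn y\<close>
  and \<open>side y\<close>, map disjoint subintervals of [-1,1] onto [-1,1]. The values 2 at 0 and
  -2 at 1/2 and -1/2 leave gaps around these points, so \<open>sgn\<close> and \<open>side\<close>
  are continuous on \<open>heights\<close>.\<close>

definition zigzag :: "real \<Rightarrow> real" where
  "zigzag y = 8 * \<bar>\<bar>y\<bar> - 1/2\<bar> - 2"

definition side :: "real \<Rightarrow> real" where
  "side y = sgn (\<bar>y\<bar> - 1/2)"

definition heights :: "real set" where
  "heights = {y. \<forall>n. \<bar>(zigzag ^^ n) y\<bar> \<le> 1}"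

text \<open>The bits are imposed by weak inequalities to make the set visibly closed; equality never
  occurs, as orbits in \<open>heights\<close> avoid 1/2 and -1/2.\<close>

definition fibre :: "nat set \<Rightarrow> real set" where
  "fibre M = {y. \<forall>n. \<bar>(zigzag ^^ n) y\<bar> \<le> 1 \<and>
     0 \<le> (if n \<in> M then 1 else -1) * (\<bar>(zigzag ^^ n) y\<bar> - 1/2)}"

lemma fibre_subset: "fibre M \<subseteq> heights"
  by (auto simp: fibre_def heights_def)

lemma abs_height_le: "y \<in> heights \<Longrightarrow> \<bar>y\<bar> \<le> 1"
  unfolding heights_def by (auto dest: spec[of _ 0])

lemma zigzag_heights: "y \<in> heights \<Longrightarrow> zigzag y \<in> heights"
  unfolding heights_def by (auto simp: funpow_swap1 dest: spec[of _ "Suc _"])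

lemma funpow_heights: "y \<in> heights \<Longrightarrow> (zigzag ^^ n) y \<in> heights"
  by (induction n) (auto intro: zigzag_heights)

lemma zigzag_minus [simp]: "zigzag (- y) = zigzag y"
  and side_minus [simp]: "side (- y) = side y"
  by (simp_all add: zigzag_def side_def)

lemma side_zigzag_eq: "side y * (zigzag y + 2) / 8 = \<bar>y\<bar> - 1/2"
  using sgn_mult_abs[of "\<bar>y\<bar> - 1/2"] by (simp add: zigzag_def side_def)

lemma height_eq:
  assumes "y \<in> heights"
  shows "y = sgn y * (1/2 + side y * (zigzag y + 2) / 8)"
    and "sgn y = 1 \<or> sgn y = -1" and "side y = 1 \<or> side y = -1"
    and "\<bar>zigzag y\<bar> \<le> 1" and "y \<noteq> 0" and "\<bar>y\<bar> \<noteq> 1/2"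
proof -
  show *: "\<bar>zigzag y\<bar> \<le> 1"
    using abs_height_le[OF zigzag_heights[OF assms]] .
  show "y \<noteq> 0"
    using * by (auto simp: zigzag_def)
  show "\<bar>y\<bar> \<noteq> 1/2"
    using * by (intro notI) (simp add: zigzag_def)
  have "sgn x = 1 \<or> sgn x = -1" if "x \<noteq> 0" for x :: real
    using that by (simp add: sgn_if)
  then show "sgn y = 1 \<or> sgn y = -1" "side y = 1 \<or> side y = -1"
    using \<open>y \<noteq> 0\<close> \<open>\<bar>y\<bar> \<noteq> 1/2\<close> by (simp_all add: side_def)
  have "1/2 + side y * (zigzag y + 2) / 8 = \<bar>y\<bar>"
    using side_zigzag_eq[of y] by linarith
  then show "y = sgn y * (1/2 + side y * (zigzag y + 2) / 8)"
    by (simp only: sgn_mult_abs)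
qed

lemma abs_side_mult:
  assumes "y \<in> heights"
  shows "\<bar>side y * a\<bar> = \<bar>a\<bar>"
  using height_eq(3)[OF assms] by (auto simp: abs_mult)

lemma abs_sgn_mult:
  assumes "y \<in> heights"
  shows "\<bar>sgn y * a\<bar> = \<bar>a\<bar>"
  using height_eq(2)[OF assms] by (auto simp: abs_mult)

lemma continuous_zigzag: "continuous_on A zigzag"
  unfolding zigzag_def by (intro continuous_intros)

lemma continuous_funpow_zigzag: "continuous_on A (\<lambda>y. (zigzag ^^ n) y)"
proof (induction n)
  case (Suc n)
  then show ?case
    by (auto intro: continuous_on_compose2[OF continuous_zigzag[of UNIV]])
qed simp

lemma continuous_side: "continuous_on heights side"
  unfolding side_def using height_eq(6) by (intro continuous_intros) auto

lemma continuous_sgn_heights: "continuous_on heights sgn"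
  using height_eq(5) by (intro continuous_intros) auto

lemma compact_fibre: "compact (fibre M)"
proof -
  have "closed (fibre M)"
    unfolding fibre_def
    by (intro closed_Collect_all closed_Collect_conj closed_Collect_le continuous_intros continuous_funpow_zigzag)
  moreover have "fibre M \<subseteq> {-1..1}"
    using fibre_subset abs_height_le by fastforce
  ultimately show ?thesis
    by (metis compact_Icc compact_Int_closed inf.absorb_iff2)
qed

lemma side_funpow_fibre:
  assumes "y \<in> fibre M"
  shows "side ((zigzag ^^ n) y) = (if n \<in> M then 1 else -1)"
proof -
  have "0 \<le> (if n \<in> M then 1 else -1) * (\<bar>(zigzag ^^ n) y\<bar> - 1/2)"
    using assms by (auto simp: fibre_def)
  moreover have "\<bar>(zigzag ^^ n) y\<bar> \<noteq> 1/2"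
    using assms fibre_subset height_eq(6)[OF funpow_heights] by blast
  ultimately show ?thesis
    by (auto simp: side_def sgn_if split: if_splits)
qed

lemma zigzag_branch:
  assumes "\<bar>y\<bar> \<le> 1" "s = 1 \<or> s = -1" "t = 1 \<or> t = -1"
  defines "x \<equiv> s * (1/2 + t * (y + 2) / 8)"
  shows "zigzag x = y" "\<bar>x\<bar> \<le> 1" "sgn x = s" "0 \<le> t * (\<bar>x\<bar> - 1/2)"
proof -
  define r where "r = (y + 2) / 8"
  have "1/8 \<le> r" "r \<le> 3/8" "y = 8 * r - 2"
    using assms(1) by (auto simp: r_def add_divide_distrib)
  moreover have "x = s * (1/2 + t * r)"
    by (simp add: x_def r_def)
  ultimately show "zigzag x = y" "\<bar>x\<bar> \<le> 1" "sgn x = s" "0 \<le> t * (\<bar>x\<bar> - 1/2)"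
    using assms(2,3) by (auto simp: zigzag_def sgn_if abs_if)
qed

text \<open>The bit at 0 forces the side of the preimage but leaves its sign free. This freedom is
  what allows every coordinate value to be realised over a single \<open>M\<close>.\<close>

lemma fibre_branch:
  assumes "y \<in> fibre {n. Suc n \<in> M}" "s = 1 \<or> s = -1"
  obtains x where "x \<in> fibre M" "zigzag x = y" "sgn x = s"
proof -
  define t :: real where "t = (if 0 \<in> M then 1 else -1)"
  define x where "x = s * (1/2 + t * (y + 2) / 8)"
  have "\<bar>y\<bar> \<le> 1"
    using assms(1) fibre_subset abs_height_le by blast
  then have x: "zigzag x = y" "\<bar>x\<bar> \<le> 1" "sgn x = s" "0 \<le> t * (\<bar>x\<bar> - 1/2)"
    using zigzag_branch[of y s t] assms(2) by (auto simp: x_def t_def)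
  have "\<bar>(zigzag ^^ n) x\<bar> \<le> 1 \<and> 0 \<le> (if n \<in> M then 1 else -1) * (\<bar>(zigzag ^^ n) x\<bar> - 1/2)" for n
  proof (cases n)
    case 0
    then show ?thesis
      using x by (simp add: t_def)
  next
    case (Suc m)
    then have "(zigzag ^^ n) x = (zigzag ^^ m) y"
      using x(1) by (simp add: funpow_swap1)
    then show ?thesis
      using assms(1) Suc by (simp add: fibre_def)
  qed
  then have "x \<in> fibre M"
    by (simp add: fibre_def)
  then show ?thesis
    using that x by blast
qed

text \<open>The conditions on the first \<open>N\<close> iterates define decreasing compact sets.
  Each is nonempty by induction, pulling a point for the shifted \<open>M\<close> back along an
  inverse branch of \<open>zigzag\<close>.\<close>

lemma fibre_nonempty: "fibre M \<noteq> {}"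
proof -
  define F where "F N = {y. \<bar>y\<bar> \<le> 1 \<and> (\<forall>n<N. \<bar>(zigzag ^^ n) y\<bar> \<le> 1 \<and>
     0 \<le> (if n \<in> M then 1 else -1) * (\<bar>(zigzag ^^ n) y\<bar> - 1/2))}" for N
  have "\<exists>y. \<bar>y\<bar> \<le> 1 \<and> (\<forall>n<N. \<bar>(zigzag ^^ n) y\<bar> \<le> 1 \<and>
     0 \<le> (if n \<in> M then 1 else -1) * (\<bar>(zigzag ^^ n) y\<bar> - 1/2))" for N
  proof (induction N arbitrary: M)
    case 0
    show ?case
      by (intro exI[of _ 0]) simp
  next
    case (Suc N)
    obtain y where y: "\<bar>y\<bar> \<le> 1" "\<And>n. n < N \<Longrightarrow> \<bar>(zigzag ^^ n) y\<bar> \<le> 1 \<and>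
        0 \<le> (if Suc n \<in> M then 1 else -1) * (\<bar>(zigzag ^^ n) y\<bar> - 1/2)"
      using Suc[of "{n. Suc n \<in> M}"] by auto
    define t :: real where "t = (if 0 \<in> M then 1 else -1)"
    define x where "x = 1 * (1/2 + t * (y + 2) / 8)"
    have x: "zigzag x = y" "\<bar>x\<bar> \<le> 1" "0 \<le> t * (\<bar>x\<bar> - 1/2)"
      using zigzag_branch[of y 1 t] y(1) by (auto simp: x_def t_def)
    have "\<bar>(zigzag ^^ n) x\<bar> \<le> 1 \<and> 0 \<le> (if n \<in> M then 1 else -1) * (\<bar>(zigzag ^^ n) x\<bar> - 1/2)"
      if "n < Suc N" for n
    proof (cases n)
      case 0
      then show ?thesis
        using x by (simp add: t_def)
    next
      case (Suc m)
      then have "(zigzag ^^ n) x = (zigzag ^^ m) y"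
        using x(1) by (simp add: funpow_swap1)
      then show ?thesis
        using y(2)[of m] Suc that by simp
    qed
    then show ?case
      using x(2) by blast
  qed
  then have "F N \<noteq> {}" for N
    by (auto simp: F_def)
  moreover have "compact (F N)" for N
  proof -
    have "closed (F N)"
      unfolding F_def
      by (intro closed_Collect_all closed_Collect_conj closed_Collect_imp open_Collect_const
          closed_Collect_le continuous_intros continuous_funpow_zigzag)
    moreover have "F N \<subseteq> {-1..1}"
      by (auto simp: F_def)
    ultimately show ?thesis
      by (metis compact_Icc compact_Int_closed inf.absorb_iff2)
  qed
  moreover have "F n \<subseteq> F m" if "m \<le> n" for m n
    using that by (auto simp: F_def)
  ultimately have "\<Inter> (range F) \<noteq> {}"
    by (intro compact_nest) auto
  moreover have "\<Inter> (range F) \<subseteq> fibre M"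
    unfolding F_def fibre_def by (auto simp del: funpow.simps)
  ultimately show ?thesis
    by blast
qed

subsection \<open>Caps\<close>

lemma eq_if_eighths:
  fixes a b c :: real
  assumes "\<And>n. \<bar>a - b\<bar> \<le> c * (1/8) ^ n"
  shows "a = b"
proof -
  have "(\<lambda>n. c * (1/8) ^ n) \<longlonglongrightarrow> c * 0"
    by (intro tendsto_intros LIMSEQ_power_zero) simp
  then have "\<bar>a - b\<bar> \<le> c * 0"
    by (rule LIMSEQ_le_const) (use assms in blast)
  then show ?thesis
    by simp
qed

text \<open>\<open>center y\<close> is the centre of the cap joining the strand of \<open>y\<close> at \<open>u = 1\<close>, and \<open>offset y\<close> its signed
  radius. The term of index \<open>n\<close> is nonzero only if \<open>n\<close> is the first index at which the orbit of \<open>y\<close>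
  is negative. The series form makes the continuity of \<open>offset\<close> evident, also at the points without
  such an index, where the cap degenerates to an end point.\<close>
primrec offset_term :: "nat \<Rightarrow> real \<Rightarrow> real" where
  "offset_term 0 y = - ((1 - sgn y) / 2) * side y * zigzag y / 8"
| "offset_term (Suc n) y = (1 + sgn y) / 2 * side y * offset_term n (zigzag y) / 8"

definition offset :: "real \<Rightarrow> real" where
  "offset y = (\<Sum>n. offset_term n y)"

definition center :: "real \<Rightarrow> real" where
  "center y = y - offset y"

lemma abs_offset_term_le:
  "y \<in> heights \<Longrightarrow> \<bar>offset_term n y\<bar> \<le> (1/8) ^ Suc n"
proof (induction n arbitrary: y)
  case 0
  then show ?case
    using height_eq(2-4)[of y] by (auto simp: abs_mult)
next
  case (Suc n)
  then have "\<bar>offset_term n (zigzag y)\<bar> \<le> (1/8) ^ Suc n"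
    by (simp add: zigzag_heights del: power_Suc)
  then show ?case
    using height_eq(2,3)[OF Suc.prems] by (auto simp: abs_mult)
qed

lemma summable_geometric_eighth: "summable (\<lambda>n. (1/8 :: real) ^ Suc n)"
  by (subst summable_Suc_iff) (simp add: summable_geometric)

lemma summable_offset: "y \<in> heights \<Longrightarrow> summable (\<lambda>n. offset_term n y)"
  by (rule summable_comparison_test[OF _ summable_geometric_eighth])
    (use abs_offset_term_le in auto)

lemma offset_neg:
  assumes "y \<in> heights" "y < 0"
  shows "offset y = - side y * zigzag y / 8"
proof -
  have "offset_term n y = 0" if "n \<notin> {0}" for n
    using that assms(2) by (cases n) auto
  then have "offset y = offset_term 0 y"
    unfolding offset_def by (subst suminf_finite[of "{0}"]) auto
  then show ?thesis
    using assms(2) by simp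
qed

text \<open>The head of the series vanishes, and the search for the first negative term moves on to
  \<open>zigzag y\<close>.\<close>

lemma offset_pos:
  assumes "y \<in> heights" "y > 0"
  shows "offset y = side y * offset (zigzag y) / 8"
proof -
  have "offset y = (\<Sum>n. offset_term (Suc n) y)"
    using suminf_split_head[OF summable_offset[OF assms(1)]] assms(2) by (simp add: offset_def)
  also have "\<dots> = (\<Sum>n. side y / 8 * offset_term n (zigzag y))"
    using assms(2) by (simp add: mult_ac)
  also have "\<dots> = side y / 8 * offset (zigzag y)"
    unfolding offset_def
    by (rule suminf_mult[OF summable_offset[OF zigzag_heights[OF assms(1)]]])
  finally show ?thesis
    by simp
qed

lemma abs_offset_le:
  assumes "y \<in> heights"
  shows "\<bar>offset y\<bar> \<le> 1/7"
proof -
  have "\<bar>offset y\<bar> \<le> (\<Sum>n. (1/8 :: real) ^ Suc n)"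
    unfolding offset_def real_norm_def[symmetric]
    by (rule norm_suminf_le[OF _ summable_geometric_eighth]) (use abs_offset_term_le[OF assms] in simp)
  also have "\<dots> = 1/8 * (\<Sum>n. (1/8) ^ n)"
    unfolding power_Suc by (intro suminf_mult summable_geometric) simp
  also have "\<dots> = 1/7"
    by (subst suminf_geometric) auto
  finally show ?thesis .
qed

lemma continuous_offset_term: "continuous_on heights (offset_term n)"
proof (induction n)
  case 0
  show ?case
    unfolding offset_term.simps
    by (intro continuous_intros continuous_side continuous_sgn_heights continuous_zigzag) auto
next
  case (Suc n)
  have "continuous_on heights (\<lambda>y. offset_term n (zigzag y))"
    by (rule continuous_on_compose2[OF Suc continuous_zigzag]) (auto intro: zigzag_heights)
  then show ?case
    unfolding offset_term.simps
    by (intro continuous_intros continuous_side continuous_sgn_heights) auto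
qed

lemma continuous_offset: "continuous_on heights offset"
proof -
  have "uniform_limit heights (\<lambda>n y. \<Sum>i<n. offset_term i y) offset sequentially"
    unfolding offset_def
    by (rule Weierstrass_m_test[OF _ summable_geometric_eighth])
      (use abs_offset_term_le in simp)
  then show ?thesis
    by (rule uniform_limit_theorem[rotated])
      (auto intro!: always_eventually continuous_on_sum continuous_offset_term)
qed

text \<open>The centre is the midpoint -1/4 or -3/4 of the branch interval; reflection in it changes
  the sign of \<open>zigzag y\<close>.\<close>

lemma center_neg:
  assumes "y \<in> heights" "y < 0"
  shows "center y = - (1/2 + side y / 4)"
  using height_eq(1)[OF assms(1)] offset_neg[OF assms] assms(2)
  by (simp add: center_def algebra_simps add_divide_distrib)

text \<open>The centre of \<open>y\<close> is the centre of \<open>zigzag y\<close> pulled back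
  along the inverse branch through \<open>y\<close>.\<close>

lemma center_pos:
  assumes "y \<in> heights" "y > 0"
  shows "center y = 1/2 + side y * (center (zigzag y) + 2) / 8"
  using height_eq(1)[OF assms(1)] offset_pos[OF assms] assms(2)
  by (simp add: center_def algebra_simps add_divide_distrib diff_divide_distrib)

lemma abs_center_le: "y \<in> heights \<Longrightarrow> \<bar>center y\<bar> + \<bar>offset y\<bar> \<le> 9/7"
  using abs_height_le[of y] abs_offset_le[of y] unfolding center_def by linarith

section \<open>Caps that meet are concentric\<close>

definition caps_meet :: "real \<Rightarrow> real \<Rightarrow> bool" where
  "caps_meet y z \<longleftrightarrow> \<bar>center y - center z\<bar> \<le> \<bar>offset y\<bar> + \<bar>offset z\<bar>"

text \<open>The whole span of a cap has the signs of its strand. For negative \<open>y\<close> it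
  stays within 1/7 of -1/4 or -3/4; for positive \<open>y\<close> it is an affine pullback of the
  span for \<open>zigzag y\<close>.\<close>

lemma cap_location:
  assumes "y \<in> heights" "\<bar>x - center y\<bar> \<le> \<bar>offset y\<bar>"
  shows "sgn x = sgn y" "sgn (\<bar>x\<bar> - 1/2) = side y"
proof -
  consider "y < 0" | "y > 0"
    using height_eq(5)[OF assms(1)] by linarith
  then have "sgn x = sgn y \<and> sgn (\<bar>x\<bar> - 1/2) = side y"
  proof cases
    case 1
    have "\<bar>x + (1/2 + side y / 4)\<bar> \<le> 1/7"
      using assms(2) abs_offset_le[OF assms(1)] center_neg[OF assms(1) 1] by linarith
    then show ?thesis
      using 1 height_eq(3)[OF assms(1)] by (auto simp: sgn_if abs_if split: if_splits)
  next
    case 2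
    let ?z = "zigzag y"
    define r where "r = side y * (x - 1/2)"
    have z: "\<bar>center ?z\<bar> + \<bar>offset ?z\<bar> \<le> 9/7"
      by (rule abs_center_le[OF zigzag_heights[OF assms(1)]])
    have x: "x = 1/2 + side y * r"
      using height_eq(3)[OF assms(1)] by (auto simp: r_def)
    have "\<bar>offset y\<bar> = \<bar>offset ?z\<bar> / 8"
      using abs_side_mult[OF assms(1), of "offset ?z / 8"] by (simp add: offset_pos[OF assms(1) 2])
    moreover have "x - center y = side y * (r - (center ?z + 2) / 8)"
      by (simp add: x center_pos[OF assms(1) 2] right_diff_distrib)
    ultimately have "\<bar>r - (center ?z + 2) / 8\<bar> \<le> \<bar>offset ?z\<bar> / 8"
      using assms(2) abs_side_mult[OF assms(1), of "r - (center ?z + 2) / 8"] by simp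
    \<comment> \<open>The margins are 9/7 < 2 and (2 + 9/7)/8 < 1/2.\<close>
    then have "0 < r" "r < 1/2"
      using z unfolding add_divide_distrib by (auto simp: abs_le_iff abs_if split: if_splits)
    then show ?thesis
      using 2 height_eq(3)[OF assms(1)] x by (auto simp: sgn_if abs_if)
  qed
  then show "sgn x = sgn y" "sgn (\<bar>x\<bar> - 1/2) = side y"
    by auto
qed

lemma caps_meetE:
  assumes "caps_meet y z"
  obtains x where "\<bar>x - center y\<bar> \<le> \<bar>offset y\<bar>" "\<bar>x - center z\<bar> \<le> \<bar>offset z\<bar>"
proof
  \<comment> \<open>Move from the centre of \<open>y\<close> towards that of \<open>z\<close>,
    stopping there or at the end of the span of \<open>y\<close>.\<close>
  define x where "x = (if center y \<le> center z then min (center y + \<bar>offset y\<bar>) (center z)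
    else max (center y - \<bar>offset y\<bar>) (center z))"
  show "\<bar>x - center y\<bar> \<le> \<bar>offset y\<bar>" "\<bar>x - center z\<bar> \<le> \<bar>offset z\<bar>"
    using assms by (auto simp: x_def caps_meet_def min_def max_def)
qed

lemma caps_meet_codes:
  assumes "y \<in> heights" "z \<in> heights" "caps_meet y z"
  shows "sgn y = sgn z" "side y = side z"
  using caps_meetE[OF assms(3)] cap_location[OF assms(1)] cap_location[OF assms(2)] by metis+

lemma caps_meet_zigzag:
  assumes "y \<in> heights" "z \<in> heights" "caps_meet y z" "y > 0"
  shows "\<bar>center y - center z\<bar> = \<bar>center (zigzag y) - center (zigzag z)\<bar> / 8"
    and "caps_meet (zigzag y) (zigzag z)"
proof -
  have "z > 0" and s: "side z = side y"
    using caps_meet_codes[OF assms(1-3)] assms(4) by (auto simp: sgn_if split: if_splits)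
  have diff: "center y - center z = side y * ((center (zigzag y) - center (zigzag z)) / 8)"
    by (simp add: center_pos assms \<open>z > 0\<close> s algebra_simps diff_divide_distrib add_divide_distrib)
  show *: "\<bar>center y - center z\<bar> = \<bar>center (zigzag y) - center (zigzag z)\<bar> / 8"
    unfolding diff abs_side_mult[OF assms(1)] by simp
  have "\<bar>offset y\<bar> = \<bar>offset (zigzag y)\<bar> / 8" "\<bar>offset z\<bar> = \<bar>offset (zigzag z)\<bar> / 8"
    using height_eq(3)[OF assms(1)] by (auto simp: offset_pos assms \<open>z > 0\<close> s abs_mult)
  then show "caps_meet (zigzag y) (zigzag z)"
    using assms(3) * by (simp add: caps_meet_def)
qed

text \<open>This is why caps do not cross. Meeting caps share both signs; if negative, these fix the
  centre. If positive, the caps of the \<open>zigzag\<close> images meet again with centres 8 times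
  as far apart, while that distance never exceeds two radii, 2/7.\<close>

lemma caps_meet_imp_center_eq:
  assumes "y \<in> heights" "z \<in> heights" "caps_meet y z"
  shows "center y = center z"
proof (rule eq_if_eighths)
  show "\<bar>center y - center z\<bar> \<le> (2/7) * (1/8) ^ n" for n
    using assms
  proof (induction n arbitrary: y z)
    case 0
    then show ?case
      using abs_offset_le[of y] abs_offset_le[of z] by (simp add: caps_meet_def)
  next
    case (Suc n)
    note codes = caps_meet_codes[OF Suc.prems]
    consider "y < 0" "z < 0" | "y > 0"
      using height_eq(5)[OF Suc.prems(1)] codes(1) by (auto simp: sgn_if split: if_splits)
    then show ?case
    proof cases
      case 1
      then show ?thesis
        using codes(2) by (simp add: center_neg Suc.prems)
    next
      case 2
      then show ?thesis
        using Suc.IH[OF zigzag_heights zigzag_heights caps_meet_zigzag(2), OF Suc.prems(1,2) Suc.prems 2]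
          caps_meet_zigzag(1)[OF Suc.prems 2]
        by simp
    qed
  qed
qed

subsection \<open>The planar copies\<close>

text \<open>Nested tents are disjoint. At parameter \<open>t\<close> on a tent of half-width
  \<open>\<bar>d\<bar>\<close>, horizontal distance from the axis plus height is
  \<open>\<bar>d\<bar> + t\<close>. If \<open>t < t'\<close>, then
  \<open>\<bar>d'\<bar> < \<bar>d\<bar>\<close>, so the horizontal distances differ.\<close>

lemma cap_inj_le:
  fixes t t' d d' :: real
  assumes "t' \<le> 1" "(1 - t) * d = (1 - t') * d'" "t * (1 + \<bar>d\<bar>) = t' * (1 + \<bar>d'\<bar>)"
  shows "t' \<le> t"
proof (rule ccontr)
  assume "\<not> t' \<le> t"
  have "\<bar>(1 - t) * d\<bar> = \<bar>(1 - t') * d'\<bar>"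
    using assms(2) by simp
  then have eq: "(1 - t) * \<bar>d\<bar> = (1 - t') * \<bar>d'\<bar>"
    using \<open>\<not> t' \<le> t\<close> assms(1) by (simp add: abs_mult)
  have "\<bar>d\<bar> + t = \<bar>d'\<bar> + t'"
    using eq assms(3) by (simp add: algebra_simps)
  then have "\<bar>d'\<bar> \<le> \<bar>d\<bar>" "0 < \<bar>d\<bar>"
    using \<open>\<not> t' \<le> t\<close> by linarith+
  then have "(1 - t') * \<bar>d'\<bar> \<le> (1 - t') * \<bar>d\<bar>" "(1 - t') * \<bar>d\<bar> < (1 - t) * \<bar>d\<bar>"
    using \<open>\<not> t' \<le> t\<close> assms(1) by (auto intro: mult_left_mono mult_strict_right_mono)
  then show False
    using eq by linarith
qed

lemma cap_inj:
  fixes t t' d d' :: real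
  assumes "0 < t" "t \<le> 1" "t' \<le> 1"
    and "(1 - t) * d = (1 - t') * d'" "t * (1 + \<bar>d\<bar>) = t' * (1 + \<bar>d'\<bar>)"
  shows "t = t'" "d = d' \<or> t = 1 \<and> \<bar>d\<bar> = \<bar>d'\<bar>"
proof -
  show "t = t'"
    using cap_inj_le[of t' t d d'] cap_inj_le[of t t' d' d] assms by (intro antisym) simp_all
  then show "d = d' \<or> t = 1 \<and> \<bar>d\<bar> = \<bar>d'\<bar>"
    using assms by auto
qed

text \<open>A strand consists of two straight segments from the real point \<open>y\<close>: for
  \<open>u\<close> from 0 to 1 up to the apex above \<open>center y\<close> at height
  \<open>1 + \<bar>offset y\<bar>\<close>, and for \<open>u\<close> from 0 to -1 down to depth
  \<open>1 + \<bar>y\<bar>\<close> below 0. The summand 1 keeps a degenerate cap from collapsing to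
  a point.\<close>

definition emb :: "real \<times> real \<Rightarrow> complex" where
  "emb w = (case w of (u, y) \<Rightarrow>
     Complex (y - max 0 (- u) * y - max 0 u * offset y)
       (max 0 u * (1 + \<bar>offset y\<bar>) - max 0 (- u) * (1 + \<bar>y\<bar>)))"

text \<open>The shift of the inverse limit on the rectangle of strands: the sign of the height
  selects the square root.\<close>

definition step :: "real \<times> real \<Rightarrow> real \<times> real" where
  "step w = (sgn (snd w) * sqrt ((1 + fst w) / 2), zigzag (snd w))"

definition coord :: "nat \<Rightarrow> real \<times> real \<Rightarrow> real" where
  "coord n w = fst ((step ^^ n) w)"

definition glued :: "real \<Rightarrow> real \<Rightarrow> real \<Rightarrow> bool" where
  "glued u y z \<longleftrightarrow> y = z \<or> u = -1 \<and> \<bar>y\<bar> = \<bar>z\<bar> \<or>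
     u = 1 \<and> center y = center z \<and> \<bar>offset y\<bar> = \<bar>offset z\<bar>"

lemma emb_eq_if_glued: "glued u y z \<Longrightarrow> emb (u, y) = emb (u, z)"
  by (auto simp: glued_def emb_def center_def)

text \<open>The imaginary part has the sign of \<open>u\<close>. Below the real axis all caps are
  centred at 0, and above it caps that meet are concentric, so \<open>cap_inj\<close> applies on
  either side.\<close>

lemma emb_eq_imp_glued:
  assumes "u \<in> {-1..1}" "v \<in> {-1..1}" "y \<in> heights" "z \<in> heights" "emb (u, y) = emb (v, z)"
  shows "u = v" "glued u y z"
proof -
  have Re: "y - max 0 (- u) * y - max 0 u * offset y = z - max 0 (- v) * z - max 0 v * offset z"
    and Im: "max 0 u * (1 + \<bar>offset y\<bar>) - max 0 (- u) * (1 + \<bar>y\<bar>) =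
      max 0 v * (1 + \<bar>offset z\<bar>) - max 0 (- v) * (1 + \<bar>z\<bar>)"
    using assms(5) by (simp_all add: emb_def)
  have sgn: "sgn (max 0 t * (1 + \<bar>a\<bar>) - max 0 (- t) * (1 + \<bar>b\<bar>)) = sgn t" for t a b :: real
  proof -
    have "sgn (1 + \<bar>c\<bar>) = 1" for c :: real
      by (simp add: sgn_if)
    then show ?thesis
      by (cases t "0 :: real" rule: linorder_cases) (simp_all add: sgn_mult max_def)
  qed
  have "sgn u = sgn v"
    using arg_cong[OF Im, of sgn] by (simp only: sgn)
  then consider "u = 0" "v = 0" | "u < 0" "v < 0" | "u > 0" "v > 0"
    by (auto simp: sgn_if split: if_splits)
  then have "u = v \<and> glued u y z"
  proof cases
    case 1
    then show ?thesis
      using Re by (simp add: glued_def)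
  next
    case 2
    then have eqs: "(1 - (- u)) * y = (1 - (- v)) * z" "(- u) * (1 + \<bar>y\<bar>) = (- v) * (1 + \<bar>z\<bar>)"
      using Re Im by (simp_all add: algebra_simps)
    then show ?thesis
      using cap_inj[OF _ _ _ eqs] 2 assms(1,2) by (auto simp: glued_def)
  next
    case 3
    have offs: "\<bar>(1 - u) * offset y\<bar> \<le> \<bar>offset y\<bar>" "\<bar>(1 - v) * offset z\<bar> \<le> \<bar>offset z\<bar>"
      using 3 assms(1,2) by (auto simp: abs_mult intro!: mult_left_le_one_le)
    have "center y + (1 - u) * offset y = center z + (1 - v) * offset z"
      using Re 3 by (simp add: center_def algebra_simps)
    moreover from this have "caps_meet y z"
      using offs unfolding caps_meet_def by linarith
    then have "center y = center z"
      using caps_meet_imp_center_eq assms(3,4) by blast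
    ultimately have eqs: "(1 - u) * offset y = (1 - v) * offset z"
        "u * (1 + \<bar>offset y\<bar>) = v * (1 + \<bar>offset z\<bar>)"
      using Im 3 by simp_all
    have "u = v" "offset y = offset z \<or> u = 1 \<and> \<bar>offset y\<bar> = \<bar>offset z\<bar>"
      using cap_inj[OF _ _ _ eqs] 3 assms(1,2) by auto
    then show ?thesis
      using \<open>center y = center z\<close> by (auto simp: glued_def center_def)
  qed
  then show "u = v" "glued u y z"
    by auto
qed

lemma step_eq: "step (u, y) = (fst (step (u, y)), zigzag y)"
  by (simp add: step_def)

lemma step_mem:
  assumes "w \<in> {-1..1} \<times> heights"
  shows "step w \<in> {-1..1} \<times> heights"
proof -
  define r where "r = sqrt ((1 + fst w) / 2)"
  have "0 \<le> r" "r \<le> 1"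
    using assms by (auto simp: r_def)
  then show ?thesis
    using height_eq(2)[of "snd w"] assms by (auto simp: step_def zigzag_heights simp flip: r_def)
qed

lemma funpow_step_mem: "w \<in> {-1..1} \<times> heights \<Longrightarrow> (step ^^ n) w \<in> {-1..1} \<times> heights"
  by (induction n) (simp_all only: funpow.simps comp_apply id_apply step_mem)

lemma coord_0 [simp]: "coord 0 w = fst w"
  by (simp add: coord_def)

lemma coord_Suc: "coord (Suc n) w = coord n (step w)"
  by (simp add: coord_def funpow_swap1)

lemma coord_mem: "w \<in> {-1..1} \<times> heights \<Longrightarrow> coord n w \<in> {-1..1}"
  using funpow_step_mem[of w n] by (auto simp: coord_def)

lemma coord_double:
  assumes "w \<in> {-1..1} \<times> heights"
  shows "coord n w = 2 * (coord (Suc n) w)\<^sup>2 - 1"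
  using assms
proof (induction n arbitrary: w)
  case 0
  then have "(sgn (snd w))\<^sup>2 = 1" "0 \<le> (1 + fst w) / 2"
    using height_eq(2)[of "snd w"] by auto
  then show ?case
    by (simp add: coord_Suc step_def power_mult_distrib add_divide_distrib)
next
  case (Suc n)
  then show ?case
    by (metis coord_Suc step_mem)
qed

lemma continuous_funpow_step: "continuous_on ({-1..1} \<times> heights) (step ^^ n)"
proof (induction n)
  case (Suc n)
  have "continuous_on ({-1..1} \<times> heights) step"
    unfolding step_def
    by (intro continuous_intros continuous_on_compose2[OF continuous_sgn_heights]
        continuous_on_compose2[OF continuous_zigzag[of UNIV]]) auto
  then show ?case
    unfolding funpow.simps comp_def
    by (rule continuous_on_compose2[OF _ Suc]) (use funpow_step_mem in blast)
qed (simp add: id_def)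

lemma continuous_coord: "continuous_on ({-1..1} \<times> heights) (coord n)"
  unfolding coord_def by (intro continuous_on_fst continuous_funpow_step)

lemma continuous_emb: "continuous_on ({-1..1} \<times> heights) emb"
proof -
  have off: "continuous_on ({-1..1} \<times> heights) (\<lambda>w. offset (snd w))"
    by (rule continuous_on_compose2[OF continuous_offset continuous_on_snd[OF continuous_on_id]]) auto
  show ?thesis
    unfolding emb_def case_prod_unfold Complex_eq
    by (intro continuous_intros off)
qed

text \<open>The shift respects gluing: from \<open>u = -1\<close> it leads to \<open>u = 0\<close>
  with equal heights. From \<open>u = 1\<close> it leads to \<open>u = -1\<close> for negative
  heights and back to \<open>u = 1\<close> for positive ones.\<close>

lemma glued_step:
  assumes "y \<in> heights" "z \<in> heights" "glued u y z"
  shows "side y = side z" "fst (step (u, y)) = fst (step (u, z))"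
    "glued (fst (step (u, y))) (zigzag y) (zigzag z)"
proof -
  consider "y = z" | "u = -1" "z = - y" | "u = 1" "center y = center z" "\<bar>offset y\<bar> = \<bar>offset z\<bar>"
    using assms(3) unfolding glued_def abs_eq_iff by force
  then have "side y = side z \<and> fst (step (u, y)) = fst (step (u, z)) \<and>
    glued (fst (step (u, y))) (zigzag y) (zigzag z)"
  proof cases
    case 3
    then have "caps_meet y z"
      by (simp add: caps_meet_def)
    note codes = caps_meet_codes[OF assms(1,2) this]
    have u': "fst (step (u, y)) = sgn y" "fst (step (u, z)) = sgn z"
      using 3(1) by (simp_all add: step_def)
    have "glued (sgn y) (zigzag y) (zigzag z)"
    proof (cases "y < 0")
      case True
      then have "z < 0"
        using codes(1) by (simp add: sgn_if split: if_splits)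
      then have "\<bar>zigzag y\<bar> = \<bar>zigzag z\<bar>"
        using 3(3) True assms(1,2) abs_side_mult by (simp add: offset_neg)
      then show ?thesis
        using True by (simp add: glued_def)
    next
      case False
      then have pos: "y > 0" "z > 0"
        using codes(1) height_eq(5)[OF assms(1)] by (simp_all add: sgn_if split: if_splits)
      then have "side y * (center (zigzag y) + 2) = side y * (center (zigzag z) + 2)"
        using 3(2) codes(2) assms(1,2) by (simp add: center_pos)
      then have "center (zigzag y) = center (zigzag z)"
        using height_eq(3)[OF assms(1)] by auto
      moreover have "\<bar>offset (zigzag y)\<bar> = \<bar>offset (zigzag z)\<bar>"
        using 3(3) pos assms(1,2) abs_side_mult by (simp add: offset_pos)
      ultimately show ?thesis
        using pos by (simp add: glued_def)
    qed
    then show ?thesis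
      using codes u' by simp
  qed (auto simp: step_def glued_def)
  then show "side y = side z" "fst (step (u, y)) = fst (step (u, z))"
    "glued (fst (step (u, y))) (zigzag y) (zigzag z)"
    by auto
qed

section \<open>Coordinates and bits determine a point up to gluing\<close>

definition same_code :: "real \<Rightarrow> real \<Rightarrow> real \<Rightarrow> bool" where
  "same_code u y z \<longleftrightarrow> (\<forall>n. coord n (u, y) = coord n (u, z) \<and>
     side ((zigzag ^^ n) y) = side ((zigzag ^^ n) z))"

lemma glued_imp_same_code:
  assumes "y \<in> heights" "z \<in> heights" "glued u y z"
  shows "same_code u y z"
proof -
  have "coord n (u, y) = coord n (u, z) \<and> side ((zigzag ^^ n) y) = side ((zigzag ^^ n) z)" for n
    using assms
  proof (induction n arbitrary: u y z)
    case 0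
    then show ?case
      using glued_step(1) by simp
  next
    case (Suc n)
    let ?u = "fst (step (u, y))"
    have "step (u, y) = (?u, zigzag y)" "step (u, z) = (?u, zigzag z)"
      using step_eq glued_step(2)[OF Suc.prems] by metis+
    then show ?case
      using Suc.IH[OF zigzag_heights zigzag_heights glued_step(3)[OF Suc.prems]] Suc.prems(1,2)
      by (simp add: coord_Suc funpow_swap1)
  qed
  then show ?thesis
    by (simp add: same_code_def)
qed

lemma same_code_step:
  assumes "same_code u y z"
  shows "side y = side z" "fst (step (u, y)) = fst (step (u, z))"
    "same_code (fst (step (u, y))) (zigzag y) (zigzag z)"
proof -
  show "side y = side z"
    using assms[unfolded same_code_def, rule_format, of 0] by simp
  show eq: "fst (step (u, y)) = fst (step (u, z))"
    using assms[unfolded same_code_def, rule_format, of 1] by (simp add: coord_Suc)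
  let ?u = "fst (step (u, y))"
  have "step (u, y) = (?u, zigzag y)" "step (u, z) = (?u, zigzag z)"
    using step_eq eq by metis+
  then show "same_code ?u (zigzag y) (zigzag z)"
    unfolding same_code_def
    using assms[unfolded same_code_def, rule_format, of "Suc _"]
    by (metis coord_Suc funpow_swap1 funpow_simps_right(2) comp_apply)
qed

text \<open>All further coordinates stay nonzero and interior, so they reveal the sign of each
  height. Together with the bits this puts both orbits on the same branches, each contracting
  distances by 8.\<close>

lemma same_code_interior:
  assumes "same_code u y z" "y \<in> heights" "z \<in> heights" "u \<in> {-1<..<1}"
  shows "y = z"
proof (rule eq_if_eighths)
  fix n
  show "\<bar>y - z\<bar> \<le> 2 * (1/8) ^ n"
    using assms
  proof (induction n arbitrary: u y z)
    case 0
    then show ?case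
      using abs_height_le[of y] abs_height_le[of z] by simp
  next
    case (Suc n)
    define r where "r = sqrt ((1 + u) / 2)"
    have r: "0 < r" "r < 1"
      using Suc.prems(4) by (simp_all add: r_def)
    note * = same_code_step[OF Suc.prems(1)]
    have u': "fst (step (u, y)) = sgn y * r"
      by (simp add: step_def r_def)
    have "sgn y = sgn z"
      using *(2) r by (simp add: step_def r_def)
    have "fst (step (u, y)) \<in> {-1<..<1}"
      using height_eq(2)[OF Suc.prems(2)] r unfolding u' by auto
    then have "\<bar>zigzag y - zigzag z\<bar> \<le> 2 * (1/8) ^ n"
      using Suc.IH *(3) Suc.prems(2,3) zigzag_heights by blast
    moreover have diff: "y - z = sgn y * (side y * ((zigzag y - zigzag z) / 8))"
      using height_eq(1)[OF Suc.prems(2)] height_eq(1)[OF Suc.prems(3)]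
      unfolding \<open>sgn y = sgn z\<close>[symmetric] *(1)[symmetric]
      by (simp add: algebra_simps add_divide_distrib diff_divide_distrib)
    have "\<bar>y - z\<bar> = \<bar>zigzag y - zigzag z\<bar> / 8"
      unfolding diff abs_sgn_mult[OF Suc.prems(2)] abs_side_mult[OF Suc.prems(2)] by simp
    ultimately show ?case
      by simp
  qed
qed

lemma same_code_left:
  assumes "same_code (-1) y z" "y \<in> heights" "z \<in> heights"
  shows "\<bar>y\<bar> = \<bar>z\<bar>"
proof -
  note * = same_code_step[OF assms(1)]
  have "zigzag y = zigzag z"
    using *(3) assms(2,3) by (intro same_code_interior[of 0]) (simp_all add: step_def zigzag_heights)
  then have "\<bar>y\<bar> - 1/2 = \<bar>z\<bar> - 1/2"
    using *(1) side_zigzag_eq by metis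
  then show ?thesis
    by simp
qed

text \<open>The next coordinate is \<open>sgn y\<close>. A negative sign reduces to the case
  \<open>u = -1\<close>; a positive one repeats the situation at scale 1/8. The initial bound 3
  exceeds 2 * 9/7.\<close>

lemma same_code_right:
  assumes "same_code 1 y z" "y \<in> heights" "z \<in> heights"
  shows "center y = center z" "\<bar>offset y\<bar> = \<bar>offset z\<bar>"
proof -
  have "\<bar>center y - center z\<bar> \<le> 3 * (1/8) ^ n \<and> \<bar>\<bar>offset y\<bar> - \<bar>offset z\<bar>\<bar> \<le> 3 * (1/8) ^ n" for n
    using assms
  proof (induction n arbitrary: y z)
    case 0
    then show ?case
      using abs_center_le[of y] abs_center_le[of z] by auto
  next
    case (Suc n)
    note * = same_code_step[OF Suc.prems(1)]
    have u': "fst (step (1, y)) = sgn y" and sgn: "sgn y = sgn z"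
      using *(2) by (simp_all add: step_def)
    show ?case
    proof (cases "y < 0")
      case True
      then have "z < 0"
        using sgn by (simp add: sgn_if split: if_splits)
      have "\<bar>zigzag y\<bar> = \<bar>zigzag z\<bar>"
        using *(3) True Suc.prems(2,3) unfolding u'
        by (intro same_code_left) (simp_all add: zigzag_heights)
      then have "\<bar>offset y\<bar> = \<bar>offset z\<bar>" "center y = center z"
        using True \<open>z < 0\<close> Suc.prems(2,3) *(1) abs_side_mult
        by (simp_all add: offset_neg center_neg)
      then show ?thesis
        by simp
    next
      case False
      then have pos: "y > 0" "z > 0"
        using sgn height_eq(5)[OF Suc.prems(2)] by (simp_all add: sgn_if split: if_splits)
      have IH: "\<bar>center (zigzag y) - center (zigzag z)\<bar> \<le> 3 * (1/8) ^ n"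
          "\<bar>\<bar>offset (zigzag y)\<bar> - \<bar>offset (zigzag z)\<bar>\<bar> \<le> 3 * (1/8) ^ n"
        using Suc.IH[of "zigzag y" "zigzag z"] *(3) pos Suc.prems(2,3) unfolding u'
        by (simp_all add: zigzag_heights)
      have diff: "center y - center z = side y * ((center (zigzag y) - center (zigzag z)) / 8)"
        using pos Suc.prems(2,3) *(1)
        by (simp add: center_pos algebra_simps add_divide_distrib diff_divide_distrib)
      have "\<bar>center y - center z\<bar> = \<bar>center (zigzag y) - center (zigzag z)\<bar> / 8"
        unfolding diff abs_side_mult[OF Suc.prems(2)] by simp
      moreover have diff': "\<bar>offset y\<bar> - \<bar>offset z\<bar> = (\<bar>offset (zigzag y)\<bar> - \<bar>offset (zigzag z)\<bar>) / 8"
        using pos Suc.prems(2,3) abs_side_mult by (simp add: offset_pos diff_divide_distrib)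
      have "\<bar>\<bar>offset y\<bar> - \<bar>offset z\<bar>\<bar> = \<bar>\<bar>offset (zigzag y)\<bar> - \<bar>offset (zigzag z)\<bar>\<bar> / 8"
        unfolding diff' by simp
      ultimately show ?thesis
        using IH by simp
    qed
  qed
  then show "center y = center z" "\<bar>offset y\<bar> = \<bar>offset z\<bar>"
    using eq_if_eighths by blast+
qed

lemma same_code_imp_glued:
  assumes "same_code u y z" "y \<in> heights" "z \<in> heights" "u \<in> {-1..1}"
  shows "glued u y z"
proof -
  consider "u = -1" | "u = 1" | "u \<in> {-1<..<1}"
    using assms(4) by fastforce
  then show ?thesis
  proof cases
    case 1
    then show ?thesis
      using same_code_left assms(1-3) by (simp add: glued_def)
  next
    case 2
    then show ?thesis
      using same_code_right assms(1-3) by (simp add: glued_def)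
  next
    case 3
    then show ?thesis
      using same_code_interior[OF assms(1-3)] by (simp add: glued_def)
  qed
qed

section \<open>The continua and their coordinates\<close>

definition knaster :: "nat set \<Rightarrow> complex set" where
  "knaster M = emb ` ({-1..1} \<times> fibre M)"

text \<open>The preimage ranges over all \<open>heights\<close>, so one function serves every
  \<open>M\<close>. Its choice is immaterial because points with equal image under
  \<open>emb\<close> are glued and hence share their coordinates.\<close>

definition proj :: "nat \<Rightarrow> complex \<Rightarrow> real" where
  "proj n z = coord n (SOME w. w \<in> {-1..1} \<times> heights \<and> emb w = z)"

lemma proj_emb:
  assumes "w \<in> {-1..1} \<times> heights"
  shows "proj n (emb w) = coord n w"
proof -
  define w' where "w' = (SOME w'. w' \<in> {-1..1} \<times> heights \<and> emb w' = emb w)"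
  have w': "w' \<in> {-1..1} \<times> heights" "emb w' = emb w"
    using someI[of "\<lambda>w'. w' \<in> {-1..1} \<times> heights \<and> emb w' = emb w" w] assms by (auto simp: w'_def)
  have "fst w' = fst w" "glued (fst w') (snd w') (snd w)"
    using emb_eq_imp_glued[of "fst w'" "fst w" "snd w'" "snd w"] w' assms by auto
  then have "same_code (fst w') (snd w') (snd w)"
    using glued_imp_same_code w' assms by (metis mem_Times_iff)
  then have "coord n w' = coord n w"
    using \<open>fst w' = fst w\<close> unfolding same_code_def by (metis prod.collapse)
  then show ?thesis
    by (simp add: proj_def w'_def)
qed

lemma coord_surj:
  assumes "u \<in> {-1..1}"
  shows "\<exists>w \<in> {-1..1} \<times> fibre M. coord n w = u"
  using assms
proof (induction n arbitrary: M)
  case 0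
  then show ?case
    using fibre_nonempty[of M] by (auto simp: ex_in_conv[symmetric])
next
  case (Suc n)
  then obtain v y where w: "v \<in> {-1..1}" "y \<in> fibre {n. Suc n \<in> M}" "coord n (v, y) = u"
    by fastforce
  \<comment> \<open>The sign of the new height must select the root \<open>v\<close> of
    \<open>2 * v\<^sup>2 - 1\<close>; for \<open>v = 0\<close> either sign would do.\<close>
  define s :: real where "s = (if v \<ge> 0 then 1 else -1)"
  then have "s = 1 \<or> s = -1"
    by simp
  then obtain x where x: "x \<in> fibre M" "zigzag x = y" "sgn x = s"
    using fibre_branch[OF w(2)] by blast
  have "v\<^sup>2 \<le> 1"
    using w(1) by (simp add: abs_square_le_1 abs_le_iff)
  then have "2 * v\<^sup>2 - 1 \<in> {-1..1}"
    by simp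
  moreover have "step (2 * v\<^sup>2 - 1, x) = (v, y)"
    using x by (simp add: step_def s_def)
  then have "coord (Suc n) (2 * v\<^sup>2 - 1, x) = u"
    using w(3) by (simp add: coord_Suc)
  ultimately show ?case
    using x(1) by blast
qed

lemma box_subset: "{-1..1} \<times> fibre M \<subseteq> {-1..1} \<times> heights" for M
  using fibre_subset by blast

lemma proj_emb_fibre: "w \<in> {-1..1} \<times> fibre M \<Longrightarrow> proj n (emb w) = coord n w"
  using proj_emb[of w n] box_subset[of M] by blast

lemma compact_knaster: "compact (knaster M)"
  unfolding knaster_def
  by (intro compact_continuous_image continuous_on_subset[OF continuous_emb box_subset]
      compact_Times compact_fibre compact_Icc)

lemma continuous_proj: "continuous_on (knaster M) (proj n)"
proof (rule continuous_from_closed_graph)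
  show "compact {-1..1 :: real}"
    by simp
  have "proj n (emb w) \<in> {-1..1}" if "w \<in> {-1..1} \<times> fibre M" for w
    unfolding proj_emb_fibre[OF that] using coord_mem[of w n] box_subset[of M] that by blast
  then show "proj n \<in> knaster M \<rightarrow> {-1..1}"
    unfolding knaster_def by blast
  \<comment> \<open>The graph is a continuous image of the compact rectangle, although
    \<open>emb\<close> has no inverse to compose with.\<close>
  have "(\<lambda>x. (x, proj n x)) ` knaster M = (\<lambda>w. (emb w, coord n w)) ` ({-1..1} \<times> fibre M)"
    unfolding knaster_def image_image
    by (rule image_cong[OF refl]) (simp only: proj_emb_fibre[of _ M])
  also have "compact \<dots>"
    by (intro compact_continuous_image continuous_on_Pair compact_Times compact_fibre compact_Icc
        continuous_on_subset[OF continuous_emb box_subset]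
        continuous_on_subset[OF continuous_coord box_subset])
  finally show "closed ((\<lambda>x. (x, proj n x)) ` knaster M)"
    by (rule compact_imp_closed)
qed

lemma proj_double:
  assumes "z \<in> knaster M"
  shows "proj n z = 2 * (proj (Suc n) z)\<^sup>2 - 1"
proof -
  obtain w where "w \<in> {-1..1} \<times> fibre M" and z: "z = emb w"
    using assms unfolding knaster_def by blast
  then have w: "w \<in> {-1..1} \<times> heights"
    using box_subset by blast
  show ?thesis
    unfolding z proj_emb[OF w] by (rule coord_double[OF w])
qed

lemma proj_separating:
  assumes z: "z \<in> knaster M" "z' \<in> knaster M" and eq: "\<And>n. proj n z = proj n z'"
  shows "z = z'"
proof -
  obtain u y where w: "z = emb (u, y)" "u \<in> {-1..1}" "y \<in> fibre M"
    using z(1) unfolding knaster_def by auto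
  obtain v y' where w': "z' = emb (v, y')" "v \<in> {-1..1}" "y' \<in> fibre M"
    using z(2) unfolding knaster_def by auto
  have c: "coord n (u, y) = coord n (v, y')" for n
    using eq[of n] proj_emb_fibre[of "(u, y)" M n] proj_emb_fibre[of "(v, y')" M n] w w' by simp
  from c[of 0] have "u = v"
    by simp
  \<comment> \<open>Both heights lie over the same \<open>M\<close>, so their bits agree
    automatically.\<close>
  then have "same_code u y y'"
    using c w(3) w'(3) by (simp add: same_code_def side_funpow_fibre)
  then have "glued u y y'"
    using same_code_imp_glued fibre_subset w w' by blast
  then show "z = z'"
    unfolding w(1) w'(1) \<open>u = v\<close>[symmetric] by (rule emb_eq_if_glued)
qed

lemma range_proj: "proj n ` knaster M = {-1..1}"
proof -
  have "proj n ` knaster M = coord n ` ({-1..1} \<times> fibre M)"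
    unfolding knaster_def image_image by (rule image_cong[OF refl]) (rule proj_emb_fibre)
  also have "\<dots> = {-1..1}"
  proof
    show "coord n ` ({-1..1} \<times> fibre M) \<subseteq> {-1..1}"
      using coord_mem box_subset by blast
    show "{-1..1} \<subseteq> coord n ` ({-1..1} \<times> fibre M)"
      using coord_surj[of _ M n] by blast
  qed
  finally show ?thesis .
qed

interpretation knaster: chebyshev_limit "knaster M" proj for M
  by unfold_locales (fact compact_knaster continuous_proj proj_double proj_separating range_proj)+

lemma knaster_disjoint:
  assumes "z \<in> knaster M" "z \<in> knaster N"
  shows "M = N"
proof -
  obtain u y where w: "z = emb (u, y)" "u \<in> {-1..1}" "y \<in> fibre M"
    using assms(1) unfolding knaster_def by auto
  obtain v y' where w': "z = emb (v, y')" "v \<in> {-1..1}" "y' \<in> fibre N"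
    using assms(2) unfolding knaster_def by auto
  have mem: "y \<in> heights" "y' \<in> heights"
    using w(3) w'(3) fibre_subset by auto
  have "emb (u, y) = emb (v, y')"
    using w(1) w'(1) by simp
  then have "same_code u y y'"
    using emb_eq_imp_glued(2)[of u v y y'] w(2) w'(2) mem glued_imp_same_code by blast
  \<comment> \<open>Gluing preserves the bits, so a common point determines the index set.\<close>
  then have "n \<in> M \<longleftrightarrow> n \<in> N" for n
    using side_funpow_fibre[OF w(3), of n] side_funpow_fibre[OF w'(3), of n]
    by (auto simp: same_code_def split: if_splits)
  then show ?thesis
    by blast
qed

lemma uncountable_nat_sets: "uncountable (UNIV :: nat set set)"
proof
  assume "countable (UNIV :: nat set set)"
  then have "from_nat_into UNIV ` (UNIV :: nat set) = (UNIV :: nat set set)"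
    by (intro range_from_nat_into) auto
  then show False
    using Cantors_theorem[of "UNIV :: nat set"] by auto
qed

theorem corollary1p3:
  "\<exists>\<X> :: complex set set. uncountable \<X> \<and> pairwise disjnt \<X> \<and>
     (\<forall>X\<in>\<X>. indecomposable_continuum X \<and> contains_dense_injective_curve X)"
proof (intro exI[of _ "range knaster"] conjI ballI)
  have "inj knaster"
  proof (rule injI)
    fix M N
    assume eq: "knaster M = knaster N"
    obtain y where "y \<in> fibre M"
      using fibre_nonempty by blast
    then have "emb (0, y) \<in> knaster M"
      unfolding knaster_def by (intro imageI) simp
    then show "M = N"
      using knaster_disjoint[of _ M N] eq by simp
  qed
  then show "uncountable (range knaster)"
    using uncountable_nat_sets countable_image_inj_on[of knaster UNIV] by auto
  show "pairwise disjnt (range knaster)"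
    unfolding pairwise_def disjnt_def using knaster_disjoint by blast
  show "indecomposable_continuum X" "contains_dense_injective_curve X" if "X \<in> range knaster" for X
    using that knaster.indecomposable knaster.dense_injective_curve by auto
qed

end
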